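(* Let $A$ be a Marot ring which is an SP-ring, let $S\subseteq \mathrm{Reg}(A)$ be a multiplicative set and let $P$ be a prime ideal of $A$. Then $A_S$ is an SP-ring; in particular, $A_{(P)}$ is an SP-ring.
   Context: All rings are commutative with $1$. For a ring $A$, $\mathrm{Reg}(A)$ is the set of regular elements (non-zerodivisors) of $A$, and a regular ideal is an ideal containing a regular element. A Marot ring is a ring in which every regular ideal is generated by regular elements. An ideal $I$ is radical if $\sqrt{I}=I$ (the whole ring counts as a radical ideal). An SP-ring is a ring in which every regular ideal is a (finite) product of radical ideals. For a prime ideal $P$ of $A$, $A_{(P)}$ denotes the regular localization $A_T$, where $T=\mathrm{Reg}(A)\cap(A\setminus P)$. *)

theory Defs
  imports "HOL-Algebra.Ideal_Product"
begin

section \<open>Regular elements, Marot rings and SP-rings\<close>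

definition Reg :: "('a, 'b) ring_scheme \<Rightarrow> 'a set" where
  "Reg A = {r \<in> carrier A. \<forall>x \<in> carrier A. r \<otimes>\<^bsub>A\<^esub> x = \<zero>\<^bsub>A\<^esub> \<longrightarrow> x = \<zero>\<^bsub>A\<^esub>}"

definition regular_ideal :: "'a set \<Rightarrow> ('a, 'b) ring_scheme \<Rightarrow> bool" where
  "regular_ideal I A \<longleftrightarrow> ideal I A \<and> I \<inter> Reg A \<noteq> {}"

definition Marot_ring :: "('a, 'b) ring_scheme \<Rightarrow> bool" where
  "Marot_ring A \<longleftrightarrow>
     cring A \<and> (\<forall>I. regular_ideal I A \<longrightarrow> (\<exists>X \<subseteq> Reg A. I = Idl\<^bsub>A\<^esub> X))"

definition ideal_sqrt :: "('a, 'b) ring_scheme \<Rightarrow> 'a set \<Rightarrow> 'a set" where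
  "ideal_sqrt A I = {a \<in> carrier A. \<exists>n::nat. n > 0 \<and> a [^]\<^bsub>A\<^esub> n \<in> I}"

definition radical_ideal :: "'a set \<Rightarrow> ('a, 'b) ring_scheme \<Rightarrow> bool" where
  "radical_ideal I A \<longleftrightarrow> ideal I A \<and> ideal_sqrt A I = I"

text \<open>The product of the empty list of ideals is the unit ideal, which is itself radical, so
  allowing empty products does not affect the notion of an SP-ring.\<close>

definition ideal_prod_list :: "('a, 'b) ring_scheme \<Rightarrow> 'a set list \<Rightarrow> 'a set" where
  "ideal_prod_list A Is = foldr (ideal_prod A) Is (carrier A)"

definition SP_ring :: "('a, 'b) ring_scheme \<Rightarrow> bool" where
  "SP_ring A \<longleftrightarrow>
     cring A \<and>
     (\<forall>I. regular_ideal I A \<longrightarrow>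
        (\<exists>Is. (\<forall>J \<in> set Is. radical_ideal J A) \<and> I = ideal_prod_list A Is))"

section \<open>Localization\<close>

text \<open>The usual ring of fractions for an arbitrary multiplicative set. The element \<open>a/s\<close> is the
  equivalence class \<open>loc_frac A S a s\<close> of the pair \<open>(a, s)\<close>. The operations are defined as unions over
  all representatives; these are unions of one and the same class, as
  \<open>add_frac\<close> and \<open>mult_frac\<close> below show.\<close>

definition frac_rel :: "('a, 'b) ring_scheme \<Rightarrow> 'a set \<Rightarrow> (('a \<times> 'a) \<times> ('a \<times> 'a)) set" where
  "frac_rel A S =
     {((a, s), (b, t)). a \<in> carrier A \<and> s \<in> S \<and> b \<in> carrier A \<and> t \<in> S \<and>
        (\<exists>u \<in> S. u \<otimes>\<^bsub>A\<^esub> (a \<otimes>\<^bsub>A\<^esub> t) = u \<otimes>\<^bsub>A\<^esub> (b \<otimes>\<^bsub>A\<^esub> s))}"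

definition loc_frac :: "('a, 'b) ring_scheme \<Rightarrow> 'a set \<Rightarrow> 'a \<Rightarrow> 'a \<Rightarrow> ('a \<times> 'a) set" where
  "loc_frac A S a s = frac_rel A S `` {(a, s)}"

definition localization :: "('a, 'b) ring_scheme \<Rightarrow> 'a set \<Rightarrow> ('a \<times> 'a) set ring" where
  "localization A S =
     \<lparr>carrier = (carrier A \<times> S) // frac_rel A S,
      mult = (\<lambda>X Y. \<Union>(a, s) \<in> X. \<Union>(b, t) \<in> Y. loc_frac A S (a \<otimes>\<^bsub>A\<^esub> b) (s \<otimes>\<^bsub>A\<^esub> t)),
      one = loc_frac A S \<one>\<^bsub>A\<^esub> \<one>\<^bsub>A\<^esub>,
      zero = loc_frac A S \<zero>\<^bsub>A\<^esub> \<one>\<^bsub>A\<^esub>,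
      add = (\<lambda>X Y. \<Union>(a, s) \<in> X. \<Union>(b, t) \<in> Y.
               loc_frac A S (a \<otimes>\<^bsub>A\<^esub> t \<oplus>\<^bsub>A\<^esub> b \<otimes>\<^bsub>A\<^esub> s) (s \<otimes>\<^bsub>A\<^esub> t))\<rparr>"

definition regular_localization :: "('a, 'b) ring_scheme \<Rightarrow> 'a set \<Rightarrow> ('a \<times> 'a) set ring" where
  "regular_localization A P = localization A (Reg A \<inter> (carrier A - P))"

locale mult_set = cring A + submonoid S A for A (structure) and S
begin

lemma S_carr [simp]: "s \<in> S \<Longrightarrow> s \<in> carrier A"
  using subset by blast

lemma frac_relI:
  assumes "a \<in> carrier A" "s \<in> S" "b \<in> carrier A" "t \<in> S" "u \<in> S"
    and "u \<otimes> (a \<otimes> t) = u \<otimes> (b \<otimes> s)"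
  shows "((a, s), (b, t)) \<in> frac_rel A S"
  using assms by (auto simp: frac_rel_def)

lemma equiv_frac_rel: "equiv (carrier A \<times> S) (frac_rel A S)"
proof (rule equivI)
  show "frac_rel A S \<subseteq> (carrier A \<times> S) \<times> (carrier A \<times> S)"
    by (auto simp: frac_rel_def)
  show "refl_on (carrier A \<times> S) (frac_rel A S)"
    by (auto simp: refl_on_def frac_rel_def intro: one_closed)
  show "sym (frac_rel A S)"
    by (auto simp: sym_def frac_rel_def) metis
  show "trans (frac_rel A S)"
  proof (rule transI, clarsimp simp: frac_rel_def)
    fix a s b t c r u v
    assume c: "a \<in> carrier A" "s \<in> S" "b \<in> carrier A" "t \<in> S" "c \<in> carrier A" "r \<in> S"
      "u \<in> S" "v \<in> S"
      and 1: "u \<otimes> (a \<otimes> t) = u \<otimes> (b \<otimes> s)" and 2: "v \<otimes> (b \<otimes> r) = v \<otimes> (c \<otimes> t)"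
    have "(u \<otimes> v \<otimes> t) \<otimes> (a \<otimes> r) = (u \<otimes> (a \<otimes> t)) \<otimes> (v \<otimes> r)"
      using c by (simp add: m_ac)
    also have "\<dots> = (v \<otimes> (b \<otimes> r)) \<otimes> (u \<otimes> s)"
      unfolding 1 using c by (simp add: m_ac)
    also have "\<dots> = (u \<otimes> v \<otimes> t) \<otimes> (c \<otimes> s)"
      unfolding 2 using c by (simp add: m_ac)
    finally show "\<exists>w\<in>S. w \<otimes> (a \<otimes> r) = w \<otimes> (c \<otimes> s)"
      using c by blast
  qed
qed

lemma frac_eq_iff:
  assumes "a \<in> carrier A" "s \<in> S" "b \<in> carrier A" "t \<in> S"
  shows "loc_frac A S a s = loc_frac A S b t \<longleftrightarrow> (\<exists>u \<in> S. u \<otimes> (a \<otimes> t) = u \<otimes> (b \<otimes> s))"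
proof -
  have "loc_frac A S a s = loc_frac A S b t \<longleftrightarrow> ((a, s), (b, t)) \<in> frac_rel A S"
    unfolding loc_frac_def using assms by (intro eq_equiv_class_iff[OF equiv_frac_rel]) auto
  then show ?thesis using assms by (simp add: frac_rel_def)
qed

lemma frac_carrier:
  "carrier (localization A S) = {loc_frac A S a s | a s. a \<in> carrier A \<and> s \<in> S}"
  by (auto simp: localization_def quotient_def loc_frac_def)

lemma frac_closed:
  "a \<in> carrier A \<Longrightarrow> s \<in> S \<Longrightarrow> loc_frac A S a s \<in> carrier (localization A S)"
  by (auto simp: frac_carrier)

lemma frac_op:
  assumes f: "\<And>a s b t a' s' b' t'. ((a, s), (a', s')) \<in> frac_rel A S \<Longrightarrow>
      ((b, t), (b', t')) \<in> frac_rel A S \<Longrightarrow>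
      ((f a s b t, s \<otimes> t), (f a' s' b' t', s' \<otimes> t')) \<in> frac_rel A S"
    and "a \<in> carrier A" "s \<in> S" "b \<in> carrier A" "t \<in> S"
  shows "(\<Union>(a, s) \<in> loc_frac A S a s. \<Union>(b, t) \<in> loc_frac A S b t. loc_frac A S (f a s b t) (s \<otimes> t))
    = loc_frac A S (f a s b t) (s \<otimes> t)"
proof -
  let ?c = "loc_frac A S (f a s b t) (s \<otimes> t)"
  have mem: "(a, s) \<in> loc_frac A S a s" "(b, t) \<in> loc_frac A S b t"
    unfolding loc_frac_def using assms(2-)
    by (auto intro: frac_relI[where u = \<one>])
  have eq: "loc_frac A S (f a' s' b' t') (s' \<otimes> t') = ?c"
    if "(a', s') \<in> loc_frac A S a s" "(b', t') \<in> loc_frac A S b t" for a' s' b' t'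
  proof -
    have "((a, s), (a', s')) \<in> frac_rel A S" "((b, t), (b', t')) \<in> frac_rel A S"
      using that by (simp_all add: loc_frac_def)
    from equiv_class_eq[OF equiv_frac_rel f[OF this]] show ?thesis
      by (simp add: loc_frac_def)
  qed
  have inner: "(\<Union>(b', t') \<in> loc_frac A S b t. loc_frac A S (f a' s' b' t') (s' \<otimes> t')) = ?c"
    if "(a', s') \<in> loc_frac A S a s" for a' s'
    using mem(2) eq[OF that] by (intro UN_constant_eq) auto
  show ?thesis
    using mem(1) inner by (intro UN_constant_eq) auto
qed

lemma mult_frac:
  assumes "a \<in> carrier A" "s \<in> S" "b \<in> carrier A" "t \<in> S"
  shows "loc_frac A S a s \<otimes>\<^bsub>localization A S\<^esub> loc_frac A S b t = loc_frac A S (a \<otimes> b) (s \<otimes> t)"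
proof -
  have "((a \<otimes> b, s \<otimes> t), (a' \<otimes> b', s' \<otimes> t')) \<in> frac_rel A S"
    if 1: "((a, s), (a', s')) \<in> frac_rel A S" and 2: "((b, t), (b', t')) \<in> frac_rel A S"
    for a s b t a' s' b' t'
  proof -
    from 1 2 obtain u v where
      c: "a \<in> carrier A" "s \<in> S" "b \<in> carrier A" "t \<in> S" "a' \<in> carrier A" "s' \<in> S"
         "b' \<in> carrier A" "t' \<in> S" "u \<in> S" "v \<in> S"
      and e: "u \<otimes> (a \<otimes> s') = u \<otimes> (a' \<otimes> s)" "v \<otimes> (b \<otimes> t') = v \<otimes> (b' \<otimes> t)"
      by (auto simp: frac_rel_def)
    have "(u \<otimes> v) \<otimes> ((a \<otimes> b) \<otimes> (s' \<otimes> t')) = (u \<otimes> (a \<otimes> s')) \<otimes> (v \<otimes> (b \<otimes> t'))"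
      using c by (simp add: m_ac)
    also have "\<dots> = (u \<otimes> v) \<otimes> ((a' \<otimes> b') \<otimes> (s \<otimes> t))"
      unfolding e using c by (simp add: m_ac)
    finally show ?thesis using c by (intro frac_relI) auto
  qed
  from frac_op[of "\<lambda>a s b t. a \<otimes> b", OF this assms] show ?thesis
    by (simp add: localization_def)
qed

lemma add_frac:
  assumes "a \<in> carrier A" "s \<in> S" "b \<in> carrier A" "t \<in> S"
  shows "loc_frac A S a s \<oplus>\<^bsub>localization A S\<^esub> loc_frac A S b t
    = loc_frac A S (a \<otimes> t \<oplus> b \<otimes> s) (s \<otimes> t)"
proof -
  have "((a \<otimes> t \<oplus> b \<otimes> s, s \<otimes> t), (a' \<otimes> t' \<oplus> b' \<otimes> s', s' \<otimes> t')) \<in> frac_rel A S"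
    if 1: "((a, s), (a', s')) \<in> frac_rel A S" and 2: "((b, t), (b', t')) \<in> frac_rel A S"
    for a s b t a' s' b' t'
  proof -
    from 1 2 obtain u v where
      c: "a \<in> carrier A" "s \<in> S" "b \<in> carrier A" "t \<in> S" "a' \<in> carrier A" "s' \<in> S"
         "b' \<in> carrier A" "t' \<in> S" "u \<in> S" "v \<in> S"
      and e: "u \<otimes> (a \<otimes> s') = u \<otimes> (a' \<otimes> s)" "v \<otimes> (b \<otimes> t') = v \<otimes> (b' \<otimes> t)"
      by (auto simp: frac_rel_def)
    have "(u \<otimes> v) \<otimes> ((a \<otimes> t \<oplus> b \<otimes> s) \<otimes> (s' \<otimes> t'))
      = (u \<otimes> (a \<otimes> s')) \<otimes> (v \<otimes> (t \<otimes> t')) \<oplus> (v \<otimes> (b \<otimes> t')) \<otimes> (u \<otimes> (s \<otimes> s'))"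
      using c by (simp add: m_ac l_distr r_distr)
    also have "\<dots> = (u \<otimes> v) \<otimes> ((a' \<otimes> t' \<oplus> b' \<otimes> s') \<otimes> (s \<otimes> t))"
      unfolding e using c by (simp add: m_ac l_distr r_distr)
    finally show ?thesis using c by (intro frac_relI[where u = "u \<otimes> v"]) auto
  qed
  from frac_op[of "\<lambda>a s b t. a \<otimes> t \<oplus> b \<otimes> s", OF this assms] show ?thesis
    by (simp add: localization_def)
qed

lemma one_frac: "\<one>\<^bsub>localization A S\<^esub> = loc_frac A S \<one> \<one>"
  and zero_frac: "\<zero>\<^bsub>localization A S\<^esub> = loc_frac A S \<zero> \<one>"
  by (simp_all add: localization_def)

lemma frac_eqI:
  assumes "a \<in> carrier A" "s \<in> S" "b \<in> carrier A" "t \<in> S" "a \<otimes> t = b \<otimes> s"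
  shows "loc_frac A S a s = loc_frac A S b t"
  using assms by (auto simp: frac_eq_iff intro!: bexI[of _ \<one>])

theorem cring_localization: "cring (localization A S)"
proof (rule cringI)
  note fr = mult_frac add_frac one_frac zero_frac
  let ?L = "localization A S"
  have elim: "\<exists>a s. x = loc_frac A S a s \<and> a \<in> carrier A \<and> s \<in> S" if "x \<in> carrier ?L" for x
    using that by (auto simp: frac_carrier)
  show "abelian_group ?L"
  proof (rule abelian_groupI)
    fix x y assume "x \<in> carrier ?L" "y \<in> carrier ?L"
    then obtain a s b t where *: "x = loc_frac A S a s" "y = loc_frac A S b t"
      "a \<in> carrier A" "s \<in> S" "b \<in> carrier A" "t \<in> S"
      using elim by metis
    show "x \<oplus>\<^bsub>?L\<^esub> y \<in> carrier ?L"
      using * by (simp add: fr frac_closed)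
    show "x \<oplus>\<^bsub>?L\<^esub> y = y \<oplus>\<^bsub>?L\<^esub> x"
      using * by (simp add: fr m_ac a_ac)
    fix z assume "z \<in> carrier ?L"
    then obtain c r where "z = loc_frac A S c r" "c \<in> carrier A" "r \<in> S"
      using elim by metis
    with * show "(x \<oplus>\<^bsub>?L\<^esub> y) \<oplus>\<^bsub>?L\<^esub> z = x \<oplus>\<^bsub>?L\<^esub> (y \<oplus>\<^bsub>?L\<^esub> z)"
      by (simp add: fr m_ac a_ac l_distr r_distr)
  next
    show "\<zero>\<^bsub>?L\<^esub> \<in> carrier ?L"
      by (simp add: fr frac_closed)
  next
    fix x assume "x \<in> carrier ?L"
    then obtain a s where x: "x = loc_frac A S a s" "a \<in> carrier A" "s \<in> S"
      using elim by metis
    then show "\<zero>\<^bsub>?L\<^esub> \<oplus>\<^bsub>?L\<^esub> x = x"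
      by (simp add: fr)
    have "loc_frac A S (\<ominus> a) s \<oplus>\<^bsub>?L\<^esub> x = \<zero>\<^bsub>?L\<^esub>"
    proof -
      have "\<ominus> a \<otimes> s \<oplus> a \<otimes> s = \<zero>"
        using x by (simp add: l_distr[symmetric] l_neg)
      then have "loc_frac A S (\<ominus> a \<otimes> s \<oplus> a \<otimes> s) (s \<otimes> s) = loc_frac A S \<zero> \<one>"
        using x by (intro frac_eqI) simp_all
      with x show ?thesis by (simp add: fr)
    qed
    then show "\<exists>y\<in>carrier ?L. y \<oplus>\<^bsub>?L\<^esub> x = \<zero>\<^bsub>?L\<^esub>"
      using x frac_closed by blast
  qed
  show "comm_monoid ?L"
  proof (rule comm_monoidI)
    fix x y assume "x \<in> carrier ?L" "y \<in> carrier ?L"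
    then obtain a s b t where *: "x = loc_frac A S a s" "y = loc_frac A S b t"
      "a \<in> carrier A" "s \<in> S" "b \<in> carrier A" "t \<in> S"
      using elim by metis
    show "x \<otimes>\<^bsub>?L\<^esub> y \<in> carrier ?L"
      using * by (simp add: fr frac_closed)
    show "x \<otimes>\<^bsub>?L\<^esub> y = y \<otimes>\<^bsub>?L\<^esub> x"
      using * by (simp add: fr m_ac)
    fix z assume "z \<in> carrier ?L"
    then obtain c r where "z = loc_frac A S c r" "c \<in> carrier A" "r \<in> S"
      using elim by metis
    with * show "(x \<otimes>\<^bsub>?L\<^esub> y) \<otimes>\<^bsub>?L\<^esub> z = x \<otimes>\<^bsub>?L\<^esub> (y \<otimes>\<^bsub>?L\<^esub> z)"
      by (simp add: fr m_ac)
  next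
    show "\<one>\<^bsub>?L\<^esub> \<in> carrier ?L"
      by (simp add: fr frac_closed)
  next
    fix x assume "x \<in> carrier ?L"
    then obtain a s where x: "x = loc_frac A S a s" "a \<in> carrier A" "s \<in> S"
      using elim by metis
    then show "\<one>\<^bsub>?L\<^esub> \<otimes>\<^bsub>?L\<^esub> x = x"
      by (simp add: fr)
  qed
  fix x y z assume "x \<in> carrier ?L" "y \<in> carrier ?L" "z \<in> carrier ?L"
  then obtain a s b t c r where *: "x = loc_frac A S a s" "y = loc_frac A S b t" "z = loc_frac A S c r"
    "a \<in> carrier A" "s \<in> S" "b \<in> carrier A" "t \<in> S" "c \<in> carrier A" "r \<in> S"
    using elim by metis
  then have "loc_frac A S ((a \<otimes> t \<oplus> b \<otimes> s) \<otimes> c) (s \<otimes> t \<otimes> r)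
    = loc_frac A S (a \<otimes> c \<otimes> (t \<otimes> r) \<oplus> b \<otimes> c \<otimes> (s \<otimes> r)) (s \<otimes> r \<otimes> (t \<otimes> r))"
    by (intro frac_eqI) (simp_all add: m_ac l_distr r_distr)
  with * show "(x \<oplus>\<^bsub>?L\<^esub> y) \<otimes>\<^bsub>?L\<^esub> z = x \<otimes>\<^bsub>?L\<^esub> z \<oplus>\<^bsub>?L\<^esub> y \<otimes>\<^bsub>?L\<^esub> z"
    by (simp add: fr)
qed

end

end

theory Submission
  imports Defs
begin

text \<open>
  Ideals of a ring of fractions are governed by ideals of \<open>A\<close>: for an ideal \<open>I\<close> of \<open>A\<close> let
  \<open>ext_ideal A S I\<close> be the set of all fractions with numerator in \<open>I\<close>, and contract an ideal of
  \<open>A\<^sub>S\<close> along \<open>a \<mapsto> a/1\<close>. Extension is a left inverse of contraction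
  (\<open>ext_contr_ideal\<close>), it commutes with finite products (\<open>ext_ideal_prod_list\<close>), and it carries
  radical ideals to radical ideals (\<open>radical_ext_ideal\<close>). When the denominators are regular,
  the numerator of a regular fraction is regular, so the contraction of a regular ideal is regular
  (\<open>regular_contr_ideal\<close>).

  Given a regular ideal of \<open>A\<^sub>S\<close>, its contraction therefore is a product of radical ideals of \<open>A\<close>,
  and extending this factorization gives one of the original ideal.
  The regular localization at \<open>P\<close> is the special case in which the denominators are the regular
  elements outside \<open>P\<close>; they form a multiplicative set because \<open>P\<close> is prime.
\<close>

section \<open>Extension and contraction of ideals\<close>

text \<open>Membership asks for one representative with numerator in \<open>I\<close>; other representatives of
  the same fraction may have numerators outside \<open>I\<close>.\<close>

definition ext_ideal :: "('a, 'b) ring_scheme \<Rightarrow> 'a set \<Rightarrow> 'a set \<Rightarrow> ('a \<times> 'a) set set" where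
  "ext_ideal A S I = {loc_frac A S a s | a s. a \<in> I \<and> s \<in> S}"

definition contr_ideal :: "('a, 'b) ring_scheme \<Rightarrow> 'a set \<Rightarrow> ('a \<times> 'a) set set \<Rightarrow> 'a set" where
  "contr_ideal A S J = {a \<in> carrier A. loc_frac A S a \<one>\<^bsub>A\<^esub> \<in> J}"

context mult_set
begin

abbreviation L where "L \<equiv> localization A S"

lemma frac_cases:
  assumes "x \<in> carrier L"
  obtains a s where "a \<in> carrier A" "s \<in> S" "x = loc_frac A S a s"
  using assms by (auto simp: frac_carrier)

lemma uminus_frac:
  assumes "a \<in> carrier A" "s \<in> S"
  shows "\<ominus>\<^bsub>L\<^esub> loc_frac A S a s = loc_frac A S (\<ominus> a) s"
proof -
  interpret L: cring L by (rule cring_localization)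
  have "\<ominus> a \<otimes> s \<oplus> a \<otimes> s = \<zero>"
    using assms by (simp add: l_distr[symmetric] l_neg)
  then have "loc_frac A S (\<ominus> a) s \<oplus>\<^bsub>L\<^esub> loc_frac A S a s = \<zero>\<^bsub>L\<^esub>"
    using assms by (simp add: add_frac zero_frac) (intro frac_eqI, simp_all)
  then show ?thesis
    using assms by (intro L.minus_equality) (auto intro: frac_closed)
qed

lemma add_frac_same_denominator:
  assumes "a \<in> carrier A" "b \<in> carrier A" "s \<in> S"
  shows "loc_frac A S a s \<oplus>\<^bsub>L\<^esub> loc_frac A S b s = loc_frac A S (a \<oplus> b) s"
  using assms by (simp add: add_frac) (intro frac_eqI, simp_all add: m_ac l_distr r_distr)

lemma nat_pow_denominator [simp]: "s \<in> S \<Longrightarrow> s [^] (n::nat) \<in> S"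
  by (induction n) auto

lemma nat_pow_frac:
  assumes "a \<in> carrier A" "s \<in> S"
  shows "loc_frac A S a s [^]\<^bsub>L\<^esub> (n::nat) = loc_frac A S (a [^] n) (s [^] n)"
proof -
  interpret L: cring L by (rule cring_localization)
  show ?thesis using assms by (induction n) (simp_all add: one_frac mult_frac)
qed

lemma ext_idealI:
  "a \<in> I \<Longrightarrow> s \<in> S \<Longrightarrow> loc_frac A S a s \<in> ext_ideal A S I"
  by (auto simp: ext_ideal_def)

lemma ideal_ext_ideal:
  assumes "ideal I A"
  shows "ideal (ext_ideal A S I) L"
proof -
  interpret L: cring L by (rule cring_localization)
  interpret I: ideal I A by fact
  have sub: "ext_ideal A S I \<subseteq> carrier L"
    by (auto simp: ext_ideal_def intro: frac_closed)
  have mult: "y \<otimes>\<^bsub>L\<^esub> x \<in> ext_ideal A S I" if "x \<in> ext_ideal A S I" "y \<in> carrier L" for x y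
  proof -
    from that obtain a s b t where xy: "x = loc_frac A S a s" "a \<in> I" "s \<in> S"
      "y = loc_frac A S b t" "b \<in> carrier A" "t \<in> S"
      by (auto simp: ext_ideal_def frac_carrier)
    then have "y \<otimes>\<^bsub>L\<^esub> x = loc_frac A S (b \<otimes> a) (t \<otimes> s)"
      by (simp add: mult_frac)
    moreover have "b \<otimes> a \<in> I" "t \<otimes> s \<in> S" using xy by (simp_all add: I.I_l_closed)
    ultimately show ?thesis by (auto simp: ext_ideal_def)
  qed
  have "subgroup (ext_ideal A S I) (add_monoid L)"
  proof (rule L.add.subgroupI)
    show "ext_ideal A S I \<subseteq> carrier L" by (rule sub)
    have "\<zero> \<in> I" by (rule additive_subgroup.zero_closed[OF I.is_additive_subgroup])
    then show "ext_ideal A S I \<noteq> {}"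
      using ext_idealI[OF _ one_closed] by blast
  next
    fix x assume "x \<in> ext_ideal A S I"
    then obtain a s where *: "x = loc_frac A S a s" "a \<in> I" "s \<in> S"
      by (auto simp: ext_ideal_def)
    then have "\<ominus> a \<in> I"
      using additive_subgroup.a_inv_closed[OF I.is_additive_subgroup] by simp
    with * show "\<ominus>\<^bsub>L\<^esub> x \<in> ext_ideal A S I"
      by (simp add: uminus_frac ext_idealI)
  next
    fix x y assume "x \<in> ext_ideal A S I" "y \<in> ext_ideal A S I"
    then obtain a s b t where *: "x = loc_frac A S a s" "a \<in> I" "s \<in> S"
      "y = loc_frac A S b t" "b \<in> I" "t \<in> S"
      by (auto simp: ext_ideal_def)
    then have "x \<oplus>\<^bsub>L\<^esub> y = loc_frac A S (a \<otimes> t \<oplus> b \<otimes> s) (s \<otimes> t)"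
      by (simp add: add_frac)
    moreover have "a \<otimes> t \<oplus> b \<otimes> s \<in> I" "s \<otimes> t \<in> S" using * by (simp_all add: I.I_r_closed)
    ultimately show "x \<oplus>\<^bsub>L\<^esub> y \<in> ext_ideal A S I" by (auto simp: ext_ideal_def)
  qed
  moreover have "x \<otimes>\<^bsub>L\<^esub> y \<in> ext_ideal A S I" if "x \<in> ext_ideal A S I" "y \<in> carrier L" for x y
    using mult[OF that] L.m_comm[of x y] that sub by auto
  ultimately show ?thesis
    using mult by (intro idealI L.ring_axioms)
qed

lemma ideal_contr_ideal:
  assumes "ideal J L"
  shows "ideal (contr_ideal A S J) A"
proof -
  interpret J: ideal J L by fact
  have mult: "y \<otimes> x \<in> contr_ideal A S J" if "x \<in> contr_ideal A S J" "y \<in> carrier A" for x y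
    using that J.I_l_closed[of "loc_frac A S x \<one>" "loc_frac A S y \<one>"]
    by (simp add: contr_ideal_def mult_frac frac_closed)
  have "subgroup (contr_ideal A S J) (add_monoid A)"
  proof (rule add.subgroupI)
    show "contr_ideal A S J \<subseteq> carrier A" by (auto simp: contr_ideal_def)
    have "\<zero> \<in> contr_ideal A S J"
      using additive_subgroup.zero_closed[OF J.is_additive_subgroup] by (simp add: contr_ideal_def zero_frac)
    then show "contr_ideal A S J \<noteq> {}" by blast
  next
    fix x assume "x \<in> contr_ideal A S J"
    then show "\<ominus> x \<in> contr_ideal A S J"
      using additive_subgroup.a_inv_closed[OF J.is_additive_subgroup, of "loc_frac A S x \<one>"]
      by (auto simp: contr_ideal_def uminus_frac)
  next
    fix x y assume "x \<in> contr_ideal A S J" "y \<in> contr_ideal A S J"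
    then show "x \<oplus> y \<in> contr_ideal A S J"
      using additive_subgroup.a_closed[OF J.is_additive_subgroup,
        of "loc_frac A S x \<one>" "loc_frac A S y \<one>"]
      by (auto simp: contr_ideal_def add_frac_same_denominator)
  qed
  moreover have "x \<otimes> y \<in> contr_ideal A S J" if "x \<in> contr_ideal A S J" "y \<in> carrier A" for x y
    using mult[OF that] m_comm[of x y] that by (simp add: contr_ideal_def)
  ultimately show ?thesis
    using mult by (intro idealI ring_axioms)
qed

text \<open>An ideal containing \<open>a/s\<close> also contains \<open>(s/1)(a/s) = a/1\<close>, so it is determined by the
  numerators of its elements.\<close>

lemma numerator_in_contr_ideal:
  assumes "ideal J L" "a \<in> carrier A" "s \<in> S" "loc_frac A S a s \<in> J"
  shows "a \<in> contr_ideal A S J"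
proof -
  interpret J: ideal J L by fact
  have "loc_frac A S s \<one> \<otimes>\<^bsub>L\<^esub> loc_frac A S a s \<in> J"
    using assms by (intro J.I_l_closed) (auto intro: frac_closed)
  moreover have "loc_frac A S (s \<otimes> a) (\<one> \<otimes> s) = loc_frac A S a \<one>"
    using assms by (intro frac_eqI) (simp_all add: m_ac)
  ultimately show ?thesis
    using assms by (simp add: contr_ideal_def mult_frac)
qed

lemma ext_contr_ideal:
  assumes "ideal J L"
  shows "ext_ideal A S (contr_ideal A S J) = J"
proof
  interpret J: ideal J L by fact
  show "J \<subseteq> ext_ideal A S (contr_ideal A S J)"
  proof
    fix x assume "x \<in> J"
    moreover from this obtain a s where "a \<in> carrier A" "s \<in> S" "x = loc_frac A S a s"
      using J.a_Hcarr frac_cases by metis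
    ultimately show "x \<in> ext_ideal A S (contr_ideal A S J)"
      using numerator_in_contr_ideal[OF assms] by (auto simp: ext_ideal_def)
  qed
  show "ext_ideal A S (contr_ideal A S J) \<subseteq> J"
  proof
    fix x assume "x \<in> ext_ideal A S (contr_ideal A S J)"
    then obtain a s where x: "x = loc_frac A S a s" "s \<in> S" "a \<in> carrier A"
      "loc_frac A S a \<one> \<in> J"
      by (auto simp: ext_ideal_def contr_ideal_def)
    have "loc_frac A S \<one> s \<otimes>\<^bsub>L\<^esub> loc_frac A S a \<one> \<in> J"
      using x by (intro J.I_l_closed) (auto intro: frac_closed)
    then show "x \<in> J" using x by (simp add: mult_frac)
  qed
qed

section \<open>Extension preserves radical ideals and products\<close>

text \<open>If \<open>(a/s)\<^sup>n = b/t\<close> with \<open>b \<in> I\<close>, clearing denominators gives some \<open>u \<in> S\<close> with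
  \<open>u a\<^sup>n t = u b s\<^sup>n \<in> I\<close>. Hence \<open>(u t a)\<^sup>n \<in> I\<close>, so \<open>u t a \<in> I\<close>, and \<open>a/s\<close> equals
  \<open>(u t a)/(u t s)\<close>.\<close>

lemma radical_ext_ideal:
  assumes "radical_ideal I A"
  shows "radical_ideal (ext_ideal A S I) L"
proof -
  interpret I: ideal I A using assms by (simp add: radical_ideal_def)
  have E: "ideal (ext_ideal A S I) L" by (rule ideal_ext_ideal) unfold_locales
  interpret E: ideal "ext_ideal A S I" L by (rule E)
  have "x \<in> ext_ideal A S I" if x: "x \<in> carrier L" and "n > 0" "x [^]\<^bsub>L\<^esub> n \<in> ext_ideal A S I"
    for x and n :: nat
  proof -
    from x obtain a s where as: "a \<in> carrier A" "s \<in> S" "x = loc_frac A S a s"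
      by (rule frac_cases)
    with that obtain b t where bt: "b \<in> I" "t \<in> S"
      "loc_frac A S (a [^] n) (s [^] n) = loc_frac A S b t"
      by (auto simp: ext_ideal_def nat_pow_frac)
    have b: "b \<in> carrier A" using bt I.a_Hcarr by blast
    with as bt obtain u where u: "u \<in> S" "u \<otimes> (a [^] n \<otimes> t) = u \<otimes> (b \<otimes> s [^] n)"
      by (auto simp: frac_eq_iff)
    obtain m where m: "n = Suc m" using \<open>n > 0\<close> gr0_conv_Suc by blast
    have "(u \<otimes> t \<otimes> a) [^] n = (u [^] m \<otimes> t [^] m) \<otimes> (u \<otimes> (a [^] n \<otimes> t))"
      using as(1) bt(2) u(1) by (simp add: m nat_pow_distrib m_ac)
    also have "\<dots> = (u [^] m \<otimes> t [^] m) \<otimes> (u \<otimes> (b \<otimes> s [^] n))"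
      by (simp only: u)
    also have "\<dots> \<in> I"
      using as bt u by (intro I.I_l_closed I.I_r_closed) auto
    finally have "u \<otimes> t \<otimes> a \<in> ideal_sqrt A I"
      using \<open>n > 0\<close> as bt u by (auto simp: ideal_sqrt_def)
    then have "u \<otimes> t \<otimes> a \<in> I" using assms by (simp add: radical_ideal_def)
    moreover have "x = loc_frac A S (u \<otimes> t \<otimes> a) (u \<otimes> t \<otimes> s)"
      unfolding as(3) using as bt u by (intro frac_eqI) (auto simp: m_ac)
    ultimately show ?thesis
      using as bt u unfolding ext_ideal_def by blast
  qed
  then have "ideal_sqrt L (ext_ideal A S I) \<subseteq> ext_ideal A S I"
    by (auto simp: ideal_sqrt_def)
  moreover have "ext_ideal A S I \<subseteq> ideal_sqrt L (ext_ideal A S I)"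
    using E.a_Hcarr by (auto simp: ideal_sqrt_def intro!: exI[of _ "1::nat"])
  ultimately show ?thesis using E by (auto simp: radical_ideal_def)
qed

text \<open>A generator \<open>i j\<close> of \<open>I J\<close> over \<open>s\<close> splits as \<open>(i/s)(j/1)\<close>, and sums can be taken over a
  common denominator; conversely \<open>(i/s)(j/t)\<close> has numerator \<open>i j\<close>, and the extension of \<open>I J\<close>,
  being an ideal, contains the sums of such fractions.\<close>

lemma ext_ideal_prod:
  assumes "ideal I A" "ideal J A"
  shows "ext_ideal A S (I \<cdot>\<^bsub>A\<^esub> J) = ext_ideal A S I \<cdot>\<^bsub>L\<^esub> ext_ideal A S J"
proof
  interpret L: cring L by (rule cring_localization)
  interpret I: ideal I A by fact
  interpret J: ideal J A by fact
  have IJ: "ideal (I \<cdot>\<^bsub>A\<^esub> J) A" by (rule ideal_prod_is_ideal[OF assms])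
  have frac: "loc_frac A S a s \<in> ext_ideal A S I \<cdot>\<^bsub>L\<^esub> ext_ideal A S J"
    if "a \<in> I \<cdot>\<^bsub>A\<^esub> J" "s \<in> S" for a s
    using that(1)
  proof (induction a rule: ideal_prod.induct)
    case (prod i j)
    have "loc_frac A S (i \<otimes> j) s = loc_frac A S i s \<otimes>\<^bsub>L\<^esub> loc_frac A S j \<one>"
      using prod that by (simp add: mult_frac)
    moreover have "loc_frac A S i s \<in> ext_ideal A S I" "loc_frac A S j \<one> \<in> ext_ideal A S J"
      using prod that by (simp_all add: ext_idealI)
    ultimately show ?case by (simp add: ideal_prod.prod)
  next
    case (sum a b)
    have "a \<in> carrier A" "b \<in> carrier A"
      using sum.hyps ideal.Icarr[OF IJ] by auto
    then have "loc_frac A S (a \<oplus> b) s = loc_frac A S a s \<oplus>\<^bsub>L\<^esub> loc_frac A S b s"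
      using that by (simp add: add_frac_same_denominator)
    then show ?case using sum.IH by (simp add: ideal_prod.sum)
  qed
  then show "ext_ideal A S (I \<cdot>\<^bsub>A\<^esub> J) \<subseteq> ext_ideal A S I \<cdot>\<^bsub>L\<^esub> ext_ideal A S J"
    by (auto simp: ext_ideal_def[of A S "I \<cdot>\<^bsub>A\<^esub> J"])
  interpret E: ideal "ext_ideal A S (I \<cdot>\<^bsub>A\<^esub> J)" L by (rule ideal_ext_ideal[OF IJ])
  show "ext_ideal A S I \<cdot>\<^bsub>L\<^esub> ext_ideal A S J \<subseteq> ext_ideal A S (I \<cdot>\<^bsub>A\<^esub> J)"
  proof
    fix x assume "x \<in> ext_ideal A S I \<cdot>\<^bsub>L\<^esub> ext_ideal A S J"
    then show "x \<in> ext_ideal A S (I \<cdot>\<^bsub>A\<^esub> J)"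
    proof (induction x rule: ideal_prod.induct)
      case (prod x y)
      then obtain i s j t where *: "x = loc_frac A S i s" "i \<in> I" "s \<in> S"
        "y = loc_frac A S j t" "j \<in> J" "t \<in> S"
        by (auto simp: ext_ideal_def)
      then have "x \<otimes>\<^bsub>L\<^esub> y = loc_frac A S (i \<otimes> j) (s \<otimes> t)"
        by (simp add: mult_frac)
      moreover have "i \<otimes> j \<in> I \<cdot>\<^bsub>A\<^esub> J" "s \<otimes> t \<in> S"
        using * by (simp_all add: ideal_prod.prod)
      ultimately show ?case by (auto simp: ext_ideal_def)
    next
      case (sum x y)
      then show ?case by (simp add: additive_subgroup.a_closed[OF E.is_additive_subgroup])
    qed
  qed
qed

lemma ideal_prod_list_is_ideal:
  assumes "\<forall>I \<in> set Is. ideal I A"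
  shows "ideal (ideal_prod_list A Is) A"
  using assms
  by (induction Is) (auto simp: ideal_prod_list_def oneideal intro: ideal_prod_is_ideal)

lemma ext_ideal_prod_list:
  assumes "\<forall>I \<in> set Is. ideal I A"
  shows "ext_ideal A S (ideal_prod_list A Is) = ideal_prod_list L (map (ext_ideal A S) Is)"
  using assms
proof (induction Is)
  case Nil
  then show ?case by (simp add: ideal_prod_list_def ext_ideal_def frac_carrier)
next
  case (Cons I Is)
  then show ?case
    using ext_ideal_prod[of I "ideal_prod_list A Is"] ideal_prod_list_is_ideal[of Is]
    by (simp add: ideal_prod_list_def)
qed

section \<open>Regular denominators\<close>

text \<open>If \<open>a x = 0\<close> then \<open>(a/s)(x/1) = 0\<close>, so \<open>x/1 = 0\<close> when \<open>a/s\<close> is regular. This forces \<open>x = 0\<close>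
  because \<open>A \<rightarrow> A\<^sub>S\<close> is injective for regular denominators.\<close>

lemma Reg_numerator:
  assumes "S \<subseteq> Reg A" "a \<in> carrier A" "s \<in> S" "loc_frac A S a s \<in> Reg L"
  shows "a \<in> Reg A"
proof -
  have "x = \<zero>" if x: "x \<in> carrier A" "a \<otimes> x = \<zero>" for x
  proof -
    have "loc_frac A S \<zero> s = loc_frac A S \<zero> \<one>"
      using assms by (intro frac_eqI) auto
    then have "loc_frac A S a s \<otimes>\<^bsub>L\<^esub> loc_frac A S x \<one> = \<zero>\<^bsub>L\<^esub>"
      using assms x by (simp add: mult_frac zero_frac)
    then have "loc_frac A S x \<one> = loc_frac A S \<zero> \<one>"
      using assms x by (auto simp: Reg_def zero_frac frac_closed)
    then obtain u where "u \<in> S" "u \<otimes> x = \<zero>"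
      using x by (auto simp: frac_eq_iff)
    then show ?thesis using assms(1) x by (auto simp: Reg_def)
  qed
  then show ?thesis using assms by (auto simp: Reg_def)
qed

lemma regular_contr_ideal:
  assumes "S \<subseteq> Reg A" "regular_ideal J L"
  shows "regular_ideal (contr_ideal A S J) A"
proof -
  from assms(2) obtain x where J: "ideal J L" and x: "x \<in> J" "x \<in> Reg L"
    by (auto simp: regular_ideal_def)
  from x have "x \<in> carrier L" by (simp add: Reg_def)
  then obtain a s where "a \<in> carrier A" "s \<in> S" "x = loc_frac A S a s"
    by (rule frac_cases)
  with x have "a \<in> contr_ideal A S J" "a \<in> Reg A"
    using numerator_in_contr_ideal[OF J] Reg_numerator[OF assms(1)] by auto
  then show ?thesis
    using ideal_contr_ideal[OF J] by (auto simp: regular_ideal_def)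
qed

theorem SP_ring_localization:
  assumes "SP_ring A" "S \<subseteq> Reg A"
  shows "SP_ring L"
proof -
  have "\<exists>Js. (\<forall>K \<in> set Js. radical_ideal K L) \<and> J = ideal_prod_list L Js"
    if J: "regular_ideal J L" for J
  proof -
    obtain Is where Is: "\<forall>K \<in> set Is. radical_ideal K A" "contr_ideal A S J = ideal_prod_list A Is"
      using assms regular_contr_ideal[OF assms(2) J] by (auto simp: SP_ring_def)
    then have "J = ideal_prod_list L (map (ext_ideal A S) Is)"
      using ext_contr_ideal[of J] ext_ideal_prod_list[of Is] J
      by (simp add: radical_ideal_def regular_ideal_def)
    then show ?thesis
      using Is radical_ext_ideal by (intro exI[of _ "map (ext_ideal A S) Is"]) auto
  qed
  then show ?thesis using cring_localization by (simp add: SP_ring_def)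
qed

end

lemma (in cring) submonoid_Reg_Diff_prime:
  assumes "primeideal P R"
  shows "submonoid (Reg R \<inter> (carrier R - P)) R"
proof -
  interpret P: primeideal P R by fact
  have "\<one> \<notin> P" using P.I_notcarr P.one_imp_carrier by blast
  moreover have "\<one> \<in> Reg R" by (simp add: Reg_def)
  moreover have "Reg R \<subseteq> carrier R" by (auto simp: Reg_def)
  moreover have "x \<otimes> y \<notin> P"
    if "x \<in> carrier R - P" "y \<in> carrier R - P" for x y
    using that P.I_prime[of x y] by blast
  moreover have "x \<otimes> y \<in> Reg R" if xy: "x \<in> Reg R" "y \<in> Reg R" for x y
  proof -
    have c: "x \<in> carrier R" "y \<in> carrier R" using xy by (simp_all add: Reg_def)
    have "z = \<zero>" if z: "z \<in> carrier R" "x \<otimes> y \<otimes> z = \<zero>" for z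
    proof -
      have "x \<otimes> (y \<otimes> z) = \<zero>" using z c by (simp add: m_assoc)
      then have "y \<otimes> z = \<zero>" using xy(1) z(1) c by (simp add: Reg_def)
      then show ?thesis using xy(2) z(1) by (simp add: Reg_def)
    qed
    then show ?thesis using c by (simp add: Reg_def)
  qed
  ultimately show ?thesis
    by (intro submonoid.intro) auto
qed

theorem proposition2p2:
  fixes A :: "('a, 'b) ring_scheme" and S P :: "'a set"
  assumes "Marot_ring A" and "SP_ring A"
    and "S \<subseteq> Reg A" and "submonoid S A"
    and "primeideal P A"
  shows "SP_ring (localization A S) \<and> SP_ring (regular_localization A P)"
proof
  interpret A: cring A using assms(2) by (simp add: SP_ring_def)
  interpret S: mult_set A S
    using assms(4) by (simp add: mult_set_def A.cring_axioms)
  show "SP_ring (localization A S)"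
    using assms(2,3) by (rule S.SP_ring_localization)
  interpret T: mult_set A "Reg A \<inter> (carrier A - P)"
    using A.submonoid_Reg_Diff_prime[OF assms(5)] by (simp add: mult_set_def A.cring_axioms)
  show "SP_ring (regular_localization A P)"
    unfolding regular_localization_def
    using assms(2) by (rule T.SP_ring_localization) blast
qed

end
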